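(* Let $P=(V_1,\dots,V_n)$ be an oriented polygon in the plane with nonzero signed area $A(P)$. For a point $O$ not lying on any of the sides of $P$ or their extensions, let $C_i$ be the circumcenter of the triangle $OV_iV_{i+1}$ and let $A_i$ be its signed area (indices cyclic mod $n$). Then the point $$ \sum_{i=1}^n \frac{A_i}{A(P)}\, C_i $$ does not depend on the choice of $O$.
   Context: A polygon $P=(V_1,\dots,V_n)$, $n\ge 3$, is a closed oriented polygon in $\mathbb{R}^2$ given by the cyclic sequence of its vertices (indices mod $n$), consecutive vertices being distinct; self-intersections are allowed. The signed area of an oriented triangle $OVW$ is $\tfrac12\det(V-O,W-O)$. The signed area of $P$ is $A(P)=\sum_i A_i$, where $A_i$ is the signed area of $OV_iV_{i+1}$; equivalently, with $V_i=(x_i,y_i)$, $A(P)=\tfrac12\sum_i (x_iy_{i+1}-x_{i+1}y_i)$. *)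

theory Defs
  imports "HOL-Analysis.Analysis"
begin

definition signed_area :: "real^2 \<Rightarrow> real^2 \<Rightarrow> real^2 \<Rightarrow> real" where
  "signed_area X V W = det (vector [V - X, W - X] :: real^2^2) / 2"

text \<open>A closed oriented polygon is the list of its vertices, read cyclically; indices start at 0.\<close>

definition vertex :: "(real^2) list \<Rightarrow> nat \<Rightarrow> real^2" where
  "vertex P i = P ! (i mod length P)"

definition polygon :: "(real^2) list \<Rightarrow> bool" where
  "polygon P \<longleftrightarrow> length P \<ge> 3 \<and> (\<forall>i < length P. vertex P i \<noteq> vertex P (i + 1))"

definition polygon_area :: "(real^2) list \<Rightarrow> real" where
  "polygon_area P =
    (\<Sum>i < length P. vertex P i $ 1 * vertex P (i + 1) $ 2
                    - vertex P (i + 1) $ 1 * vertex P i $ 2) / 2"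

definition off_side_lines :: "(real^2) list \<Rightarrow> real^2 \<Rightarrow> bool" where
  "off_side_lines P X \<longleftrightarrow>
    (\<forall>i < length P. X \<notin> affine hull {vertex P i, vertex P (i + 1)})"

text \<open>Meaningful only for non-degenerate triangles; see \<open>circumcenter_ex1\<close> below.\<close>

definition circumcenter :: "real^2 \<Rightarrow> real^2 \<Rightarrow> real^2 \<Rightarrow> real^2" where
  "circumcenter X V W = (THE C. dist C X = dist C V \<and> dist C X = dist C W)"

lemma signed_area_coords:
  "signed_area X V W =
    ((V$1 - X$1) * (W$2 - X$2) - (V$2 - X$2) * (W$1 - X$1)) / 2"
  by (simp add: signed_area_def det_2)

lemma sum_vertex_Suc:
  fixes f :: "real^2 \<Rightarrow> real"
  shows "(\<Sum>i < length P. f (vertex P (i + 1))) = (\<Sum>i < length P. f (vertex P i))"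
proof (cases "length P")
  case (Suc m)
  have "(\<Sum>i < Suc m. f (vertex P (i + 1))) = (\<Sum>i < m. f (vertex P (i + 1))) + f (vertex P 0)"
    using Suc by (simp add: vertex_def)
  also have "\<dots> = (\<Sum>i < Suc m. f (vertex P i))"
    by (subst sum.lessThan_Suc_shift) simp
  finally show ?thesis using Suc by simp
qed simp

text \<open>The area is the sum of the areas of the triangles spanned with any base point.\<close>

lemma polygon_area_base_point:
  "polygon_area P = (\<Sum>i < length P. signed_area X (vertex P i) (vertex P (i + 1)))"
proof -
  define g where "g V = V$1 * X$2 - V$2 * X$1" for V :: "real^2"
  have "signed_area X V W =
      (V$1 * W$2 - W$1 * V$2) / 2 + (g W - g V) / 2" for V W
    by (simp add: signed_area_coords g_def field_simps)
  then have "(\<Sum>i < length P. signed_area X (vertex P i) (vertex P (i + 1)))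
     = polygon_area P
       + ((\<Sum>i < length P. g (vertex P (i + 1))) - (\<Sum>i < length P. g (vertex P i))) / 2"
    by (simp add: polygon_area_def sum.distrib sum_subtractf flip: sum_divide_distrib)
  then show ?thesis
    using sum_vertex_Suc[of g P] by simp
qed

lemma signed_area_nonzero:
  assumes "V \<noteq> W" and "X \<notin> affine hull {V, W}"
  shows "signed_area X V W \<noteq> 0"
proof
  assume "signed_area X V W = 0"
  then have d: "(V$1 - X$1) * (W$2 - X$2) = (V$2 - X$2) * (W$1 - X$1)"
    by (simp add: signed_area_coords)
  define t where
    "t = (if V$1 \<noteq> W$1 then (X$1 - V$1) / (W$1 - V$1) else (X$2 - V$2) / (W$2 - V$2))"
  have ne: "V$1 \<noteq> W$1 \<or> V$2 \<noteq> W$2"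
    using assms(1) by (auto simp: vec_eq_iff forall_2)
  have "X$1 - V$1 = t * (W$1 - V$1) \<and> X$2 - V$2 = t * (W$2 - V$2)"
  proof (cases "V$1 = W$1")
    case True
    with ne have n: "V$2 \<noteq> W$2" by simp
    have "(V$1 - X$1) * (W$2 - V$2) = 0"
      using d True by (simp add: algebra_simps)
    with n have "V$1 = X$1" by simp
    with True n show ?thesis by (simp add: t_def)
  next
    case False
    then have n: "W$1 - V$1 \<noteq> 0" by simp
    have "(X$2 - V$2) * (W$1 - V$1) = (X$1 - V$1) * (W$2 - V$2)"
      using d by (simp add: algebra_simps)
    with n False show ?thesis by (simp add: t_def field_simps)
  qed
  then have "X = (1 - t) *\<^sub>R V + t *\<^sub>R W"
    by (simp add: vec_eq_iff forall_2 algebra_simps)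
  moreover have "(1 - t) + t = 1" by simp
  ultimately have "X \<in> affine hull {V, W}"
    unfolding affine_hull_2 by blast
  with assms(2) show False by simp
qed

lemma dist_eq_iff_2:
  fixes C X V :: "real^2"
  shows "dist C X = dist C V \<longleftrightarrow>
    2 * (V$1 - X$1) * (C$1 - X$1) + 2 * (V$2 - X$2) * (C$2 - X$2)
      = (V$1 - X$1)^2 + (V$2 - X$2)^2"
proof -
  have "dist C X = dist C V \<longleftrightarrow>
      (C$1 - X$1)^2 + (C$2 - X$2)^2 = (C$1 - V$1)^2 + (C$2 - V$2)^2"
    by (simp add: dist_norm norm_vec_def L2_set_def sum_2)
  then show ?thesis
    by (auto simp: power2_eq_square algebra_simps)
qed

lemma linear_system_2:
  fixes a b c d p q :: real
  assumes "a * d - b * c \<noteq> 0"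
  shows "a * x + b * y = p \<and> c * x + d * y = q \<longleftrightarrow>
    x = (p * d - q * b) / (a * d - b * c) \<and> y = (a * q - c * p) / (a * d - b * c)"
proof -
  let ?D = "a * d - b * c"
  have "a * x + b * y = p \<and> c * x + d * y = q \<longleftrightarrow>
      ?D * x = p * d - q * b \<and> ?D * y = a * q - c * p" (is "?L \<longleftrightarrow> ?R")
  proof
    assume ?L
    then show ?R by (auto simp: algebra_simps)
  next
    assume R: ?R
    have "?D * (a * x + b * y) = a * (?D * x) + b * (?D * y)" by (simp add: algebra_simps)
    also have "\<dots> = a * (p * d - q * b) + b * (a * q - c * p)" by (simp only: R)
    also have "\<dots> = ?D * p" by (simp add: algebra_simps)
    finally have 1: "a * x + b * y = p" using assms by simp
    have "?D * (c * x + d * y) = c * (?D * x) + d * (?D * y)" by (simp add: algebra_simps)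
    also have "\<dots> = c * (p * d - q * b) + d * (a * q - c * p)" by (simp only: R)
    also have "\<dots> = ?D * q" by (simp add: algebra_simps)
    finally have "c * x + d * y = q" using assms by simp
    with 1 show ?L by simp
  qed
  with assms show ?thesis by (simp add: eq_divide_eq mult.commute)
qed

lemma circumcenter_ex1:
  assumes "signed_area X V W \<noteq> 0"
  shows "\<exists>!C. dist C X = dist C V \<and> dist C X = dist C W"
proof -
  have "(2 * (V$1 - X$1)) * (2 * (W$2 - X$2)) - (2 * (V$2 - X$2)) * (2 * (W$1 - X$1))
      = 8 * signed_area X V W"
    by (simp add: signed_area_coords algebra_simps)
  with assms have D: "(2 * (V$1 - X$1)) * (2 * (W$2 - X$2))
      - (2 * (V$2 - X$2)) * (2 * (W$1 - X$1)) \<noteq> 0"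
    by (metis mult_eq_0_iff zero_neq_numeral)
  obtain u v where uv: "\<And>C. (dist C X = dist C V \<and> dist C X = dist C W)
      \<longleftrightarrow> C$1 - X$1 = u \<and> C$2 - X$2 = v"
    unfolding dist_eq_iff_2 linear_system_2[OF D] by blast
  show ?thesis
    unfolding uv
    by (rule ex1I[of _ "vector [X$1 + u, X$2 + v]"]) (auto simp: vec_eq_iff forall_2)
qed

end

theory Submission
  imports Defs
begin

text \<open>For a triangle \<open>XVW\<close> with circumcenter \<open>C\<close>, the product of \<open>C\<close> with the signed area is a
  polynomial in the coordinates.  It splits into a part that does not involve \<open>X\<close> and a difference
  \<open>G W - G V\<close>, which telescopes around the closed polygon.\<close>

lemma circumcenter_equidistant:
  assumes "signed_area X V W \<noteq> 0"
  shows "dist (circumcenter X V W) X = dist (circumcenter X V W) V"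
    and "dist (circumcenter X V W) X = dist (circumcenter X V W) W"
  using theI'[OF circumcenter_ex1[OF assms]] by (simp_all add: circumcenter_def)

text \<open>This is Cramer's rule for the perpendicular bisector equations of \<open>X V\<close> and
  \<open>X W\<close>. Multiplying by the area, which is proportional to their determinant, removes
  the denominator.\<close>

lemma signed_area_times_circumcenter:
  assumes "signed_area X V W \<noteq> 0"
  shows "signed_area X V W * circumcenter X V W $ 1 = signed_area X V W * X$1
      + (((V$1 - X$1)^2 + (V$2 - X$2)^2) * (W$2 - X$2)
         - ((W$1 - X$1)^2 + (W$2 - X$2)^2) * (V$2 - X$2)) / 4"
    and "signed_area X V W * circumcenter X V W $ 2 = signed_area X V W * X$2
      + (((W$1 - X$1)^2 + (W$2 - X$2)^2) * (V$1 - X$1)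
         - ((V$1 - X$1)^2 + (V$2 - X$2)^2) * (W$1 - X$1)) / 4"
proof -
  \<comment> \<open>Read from right to left, the bisector equations replace both squared side
    lengths in the goal by expressions linear in the circumcenter, leaving polynomial
    identities.\<close>
  note * = circumcenter_equidistant[OF assms, unfolded dist_eq_iff_2, symmetric]
  show "signed_area X V W * circumcenter X V W $ 1 = signed_area X V W * X$1
      + (((V$1 - X$1)^2 + (V$2 - X$2)^2) * (W$2 - X$2)
         - ((W$1 - X$1)^2 + (W$2 - X$2)^2) * (V$2 - X$2)) / 4"
    unfolding * signed_area_coords by (simp add: field_simps)
  show "signed_area X V W * circumcenter X V W $ 2 = signed_area X V W * X$2
      + (((W$1 - X$1)^2 + (W$2 - X$2)^2) * (V$1 - X$1)
         - ((V$1 - X$1)^2 + (V$2 - X$2)^2) * (W$1 - X$1)) / 4"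
    unfolding * signed_area_coords by (simp add: field_simps)
qed

lemma sum_vertex_telescope:
  fixes f :: "real^2 \<Rightarrow> real"
  shows "(\<Sum>i < length P. f (vertex P (i + 1)) - f (vertex P i)) = 0"
  using sum_vertex_Suc[of f P] by (simp add: sum_subtractf)

text \<open>The right-hand side is free of \<open>X\<close>, so any two admissible base points give
  the same sum. Its summands are the formulas of \<open>signed_area_times_circumcenter\<close> with
  \<open>X\<close> set to the origin, which itself may lie on a side line.\<close>

lemma sum_signed_area_circumcenter:
  assumes "polygon P" and "off_side_lines P X"
  shows "(\<Sum>i < length P. signed_area X (vertex P i) (vertex P (i + 1)) *\<^sub>R
            circumcenter X (vertex P i) (vertex P (i + 1)))
       = (\<Sum>i < length P. vector
            [((norm (vertex P i))^2 * vertex P (i + 1) $ 2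
              - (norm (vertex P (i + 1)))^2 * vertex P i $ 2) / 4,
             ((norm (vertex P (i + 1)))^2 * vertex P i $ 1
              - (norm (vertex P i))^2 * vertex P (i + 1) $ 1) / 4])"
    (is "?L = ?R")
proof -
  \<comment> \<open>Every triangle is non-degenerate, so \<open>circumcenter\<close> denotes a
    genuine circumcenter.\<close>
  have nz: "signed_area X (vertex P i) (vertex P (i + 1)) \<noteq> 0" if "i < length P" for i
    using assms that by (intro signed_area_nonzero) (auto simp: polygon_def off_side_lines_def)
  have norm2: "(norm V)^2 = (V$1)^2 + (V$2)^2" for V :: "real^2"
    by (simp add: norm_vec_def L2_set_def sum_2)
  \<comment> \<open>Expanding the formulas, the terms that mix \<open>X\<close>, \<open>V\<close>
    and \<open>W\<close> cancel: those of the area times \<open>X\<close> against those from the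
    squared lengths. Each other term involving \<open>X\<close> contains at most one of
    \<open>V\<close> and \<open>W\<close>. \<open>G\<close> and \<open>H\<close> collect the
    \<open>W\<close> terms of the two coordinates; the \<open>V\<close> terms are the same with
    opposite sign.\<close>
  define G where "G V = X$1 * (V$1 * X$2 - V$2 * X$1) / 2 + X$2 * (norm V)^2 / 4
      - X$2 * (V$1 * X$1 + V$2 * X$2) / 2 + (norm X)^2 * V$2 / 4" for V :: "real^2"
  define H where "H V = X$2 * (V$1 * X$2 - V$2 * X$1) / 2 - X$1 * (norm V)^2 / 4
      + X$1 * (V$1 * X$1 + V$2 * X$2) / 2 - (norm X)^2 * V$1 / 4" for V :: "real^2"
  have 1: "signed_area X V W * circumcenter X V W $ 1
      = ((norm V)^2 * W$2 - (norm W)^2 * V$2) / 4 + (G W - G V)"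
    if "signed_area X V W \<noteq> 0" for V W
    unfolding signed_area_times_circumcenter(1)[OF that] unfolding signed_area_coords G_def norm2
    by (simp add: field_simps power2_eq_square)
  have 2: "signed_area X V W * circumcenter X V W $ 2
      = ((norm W)^2 * V$1 - (norm V)^2 * W$1) / 4 + (H W - H V)"
    if "signed_area X V W \<noteq> 0" for V W
    unfolding signed_area_times_circumcenter(2)[OF that] unfolding signed_area_coords H_def norm2
    by (simp add: field_simps power2_eq_square)
  have "?L $ 1 = ?R $ 1 + (\<Sum>i < length P. G (vertex P (i + 1)) - G (vertex P i))"
    unfolding sum_component sum.distrib[symmetric]
    by (rule sum.cong) (simp_all add: 1 nz[simplified])
  moreover have "?L $ 2 = ?R $ 2 + (\<Sum>i < length P. H (vertex P (i + 1)) - H (vertex P i))"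
    unfolding sum_component sum.distrib[symmetric]
    by (rule sum.cong) (simp_all add: 2 nz[simplified])
  ultimately show ?thesis
    unfolding sum_vertex_telescope by (simp add: vec_eq_iff forall_2)
qed

theorem mainTheorem1:
  fixes P :: "(real^2) list" and X Y :: "real^2"
  assumes "polygon P"
    and "polygon_area P \<noteq> 0"
    and "off_side_lines P X"
    and "off_side_lines P Y"
  shows "(\<Sum>i < length P.
            (signed_area X (vertex P i) (vertex P (i + 1)) / polygon_area P) *\<^sub>R
              circumcenter X (vertex P i) (vertex P (i + 1)))
       = (\<Sum>i < length P.
            (signed_area Y (vertex P i) (vertex P (i + 1)) / polygon_area P) *\<^sub>R
              circumcenter Y (vertex P i) (vertex P (i + 1)))"
proof -
  \<comment> \<open>The weight 1 / \<open>polygon_area P\<close> is the same for every base point,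
    so comparing the unnormalized sums suffices.\<close>
  have "(\<Sum>i < length P.
            (signed_area Z (vertex P i) (vertex P (i + 1)) / polygon_area P) *\<^sub>R
              circumcenter Z (vertex P i) (vertex P (i + 1)))
      = (1 / polygon_area P) *\<^sub>R (\<Sum>i < length P.
            signed_area Z (vertex P i) (vertex P (i + 1)) *\<^sub>R
              circumcenter Z (vertex P i) (vertex P (i + 1)))" for Z
    by (simp add: scaleR_sum_right)
  then show ?thesis
    using sum_signed_area_circumcenter[OF assms(1,3)] sum_signed_area_circumcenter[OF assms(1,4)]
    by simp
qed

end
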